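(* Let $f(n,5,8)$ denote the minimum number of colors in an edge-coloring of the complete graph $K_n$ such that every copy of $K_5$ in $K_n$ receives at least $8$ distinct colors. Then for every $n\ge 1$, $f(n,5,8)\ge \frac{6}{7}(n-1)$.
   Context: A copy of $K_5$ receives at least $q$ colors if its $10$ edges carry at least $q$ distinct colors.
   Formalization: The values n = 3 and n = 4 are excluded: there K_n contains no K_5, so one color suffices and f(n,5,8) = 1, which is less than 12/7 and 18/7 respectively. *)

theory Defs
  imports Complex_Main "HOL-Library.Ramsey"
begin

text \<open>
  The edges of the complete graph on a vertex set \<open>V\<close> are the two-element subsets
  \<open>nsets V 2\<close>, and the copies of the complete graph on \<open>p\<close> vertices inside it
  are given by their vertex sets, the elements of \<open>nsets V p\<close>.
  Only the values of a colouring on the edges matter.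
\<close>

definition colors_used :: "(nat set \<Rightarrow> nat) \<Rightarrow> nat set \<Rightarrow> nat set" where
  "colors_used c V = c ` nsets V 2"

definition pq_coloring :: "nat \<Rightarrow> nat \<Rightarrow> nat \<Rightarrow> (nat set \<Rightarrow> nat) \<Rightarrow> bool" where
  "pq_coloring n p q c \<longleftrightarrow> (\<forall>S \<in> nsets {..<n} p. q \<le> card (colors_used c S))"

definition gen_ramsey :: "nat \<Rightarrow> nat \<Rightarrow> nat \<Rightarrow> nat" where
  "gen_ramsey n p q = (LEAST k. \<exists>c. pq_coloring n p q c \<and> card (colors_used c {..<n}) = k)"

text \<open>
  The minimum is attained: a rainbow colouring is always admissible if \<open>q\<close> is at most
  the number of edges of one copy.
\<close>

lemma pq_coloring_exists:
  assumes "q \<le> p choose 2"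
  shows "\<exists>c. pq_coloring n p q c"
proof -
  have "finite (nsets {..<n} 2)"
    by (simp add: finite_imp_finite_nsets)
  then obtain c :: "nat set \<Rightarrow> nat" where c: "inj_on c (nsets {..<n} 2)"
    by (auto dest: finite_imp_inj_to_nat_seg)
  have "q \<le> card (colors_used c S)" if S: "S \<in> nsets {..<n} p" for S
  proof -
    have "nsets S 2 \<subseteq> nsets {..<n} 2"
      using S by (auto simp: nsets_def)
    then have "card (colors_used c S) = card (nsets S 2)"
      unfolding colors_used_def by (intro card_image inj_on_subset[OF c])
    also have "\<dots> = p choose 2"
      using S by (simp only: card_nsets) (simp add: nsets_def)
    finally show ?thesis using assms by simp
  qed
  then show ?thesis
    unfolding pq_coloring_def by blast
qed

lemma gen_ramsey_attained:
  assumes "q \<le> p choose 2"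
  shows "\<exists>c. pq_coloring n p q c \<and> card (colors_used c {..<n}) = gen_ramsey n p q"
proof -
  let ?P = "\<lambda>k. \<exists>c. pq_coloring n p q c \<and> card (colors_used c {..<n}) = k"
  obtain c where "pq_coloring n p q c"
    using pq_coloring_exists[OF assms] by blast
  then have "?P (card (colors_used c {..<n}))" by blast
  then have "?P (LEAST k. ?P k)" by (rule LeastI[of ?P])
  then show ?thesis by (simp only: gen_ramsey_def)
qed

text \<open>
  Below \<open>p\<close> vertices the condition on copies is vacuous, so one colour suffices.  In particular
  the bound \<open>6 / 7 * (n - 1)\<close> on the value for \<open>p = 5\<close>, \<open>q = 8\<close> fails for
  \<open>n = 3\<close> and \<open>n = 4\<close>, whence their exclusion from the theorem.
\<close>

lemma gen_ramsey_le_1: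
  assumes "n < p"
  shows "gen_ramsey n p q \<le> 1"
proof -
  have "nsets {..<n} p = {}"
    using assms by (simp add: nsets_eq_empty)
  then have "pq_coloring n p q (\<lambda>_. 0)"
    by (simp add: pq_coloring_def)
  then have "gen_ramsey n p q \<le> card (colors_used (\<lambda>_. 0) {..<n})"
    unfolding gen_ramsey_def by (intro Least_le) blast
  also have "\<dots> \<le> card {0::nat}"
    by (intro card_mono) (auto simp: colors_used_def)
  finally show ?thesis by simp
qed

lemma bound_fails_3_4:
  assumes "n = 3 \<or> n = 4"
  shows "\<not> real (gen_ramsey n 5 8) \<ge> 6 / 7 * (real n - 1)"
proof -
  have "real (gen_ramsey n 5 8) \<le> 1"
    using assms gen_ramsey_le_1[of n 5 8] by linarith
  moreover have "real n \<ge> 3"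
    using assms by linarith
  ultimately show ?thesis by (simp add: not_le field_simps)
qed

end

theory Submission
  imports Defs
begin

text \<open>
  Ten edges and at least eight colours mean that five vertices carry at most two repetitions
  of a colour. Let \<open>C\<close> be the number of colours. The \<open>n * (n - 1)\<close> pairs \<open>(v, x)\<close> map to the
  \<open>n * C\<close> pairs \<open>(v, colour of vx)\<close>, and it suffices that the pairs lost by this
  map (one for each redundant edge at \<open>v\<close>), minus the pairs \<open>(v, b)\<close> where \<open>b\<close> is missing
  at \<open>v\<close>, number at most \<open>n * (n - 1) / 7\<close>.

  A loss comes from \<open>vx\<close>, \<open>vy\<close> of the same colour; let \<open>b\<close> be the colour of \<open>xy\<close>.
  If \<open>b\<close> is missing at \<open>v\<close>, the missing pair \<open>(v, b)\<close> pays, and it pays only once.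
  If \<open>vxy\<close> is monochromatic, its colour occurs nowhere else, so its three losses are paid
  by the \<open>n - 3 \<ge> 3\<close> other vertices.
  Otherwise some \<open>vz\<close> with \<open>z \<noteq> x, y\<close> has colour \<open>b\<close>, and the four vertices already carry two
  repetitions. This makes the edges \<open>vx\<close>, \<open>vy\<close>, \<open>xy\<close> and the oriented edge \<open>(v, z)\<close> private
  to the loss, so each such loss occupies seven of the \<open>n * (n - 1)\<close> ordered pairs.
\<close>

section \<open>Colour repetitions on at most five vertices\<close>

locale coloring_5_8 =
  fixes n :: nat and c :: "nat set \<Rightarrow> nat"
  assumes n5: "5 \<le> n" and coloring: "pq_coloring n 5 8 c"
begin

definition col :: "nat \<Rightarrow> nat \<Rightarrow> nat" where
  "col u v = c {u, v}"

lemma col_commute: "col u v = col v u"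
  by (simp add: col_def insert_commute)

definition edges :: "nat set \<Rightarrow> nat set set" where
  "edges S = nsets S 2"

lemma doubleton_in_edges: "{u, v} \<in> edges S \<longleftrightarrow> u \<in> S \<and> v \<in> S \<and> u \<noteq> v"
  by (auto simp: edges_def nsets_def card_insert_if)

text \<open>Extend \<open>S\<close> to five vertices. The 10 - |E| edges outside \<open>E\<close>
  add at most that many colours to those of \<open>E\<close>, so \<open>E\<close> itself carries at
  least 8 - (10 - |E|) = |E| - 2.\<close>

lemma card_edges_le:
  assumes S: "S \<subseteq> {..<n}" "card S \<le> 5" and E: "E \<subseteq> edges S"
  shows "card E \<le> card (c ` E) + 2"
proof -
  have "finite S" using S finite_subset by blast
  obtain T where T: "S \<subseteq> T" "T \<subseteq> {..<n}" "card T = 5"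
    using exists_subset_between[of S 5 "{..<n}"] S n5 by auto
  then have "T \<in> nsets {..<n} 5"
    by (auto simp: nsets_def intro: finite_subset)
  then have "8 \<le> card (c ` nsets T 2)"
    using coloring by (auto simp: pq_coloring_def colors_used_def)
  moreover have ET: "E \<subseteq> nsets T 2"
    using E T nsets_mono[of S T 2] by (auto simp: edges_def)
  moreover have finT: "finite (nsets T 2)"
    using T by (intro finite_imp_finite_nsets) (auto intro: finite_subset)
  moreover have "card (nsets T 2) = 10"
    using T by (simp add: card_nsets choose_two)
  moreover have "c ` nsets T 2 = c ` E \<union> c ` (nsets T 2 - E)"
    using ET by auto
  moreover have "card (c ` E \<union> c ` (nsets T 2 - E)) \<le> card (c ` E) + card (c ` (nsets T 2 - E))"
    by (rule card_Un_le)
  moreover have "card (c ` (nsets T 2 - E)) \<le> card (nsets T 2 - E)"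
    using finT by (intro card_image_le) auto
  moreover have "card (nsets T 2 - E) = card (nsets T 2) - card E"
    using ET finT by (meson card_Diff_subset finite_subset)
  moreover have "card E \<le> card (nsets T 2)"
    using ET finT by (rule card_mono[rotated])
  ultimately show ?thesis by simp
qed

text \<open>Each f repeats the colour of an edge outside {f1, f2, f3}, so deleting the three f's
  loses no colour. The g's may coincide, which lets one edge witness several repetitions.\<close>

lemma no_three_repetitions:
  assumes S: "S \<subseteq> {..<n}" "card S \<le> 5"
    and "f1 \<in> edges S" "f2 \<in> edges S" "f3 \<in> edges S"
    and "g1 \<in> edges S" "g2 \<in> edges S" "g3 \<in> edges S"
    and "f1 \<noteq> f2" "f1 \<noteq> f3" "f2 \<noteq> f3"
    and "g1 \<notin> {f1, f2, f3}" "g2 \<notin> {f1, f2, f3}" "g3 \<notin> {f1, f2, f3}"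
    and "c f1 = c g1" "c f2 = c g2" "c f3 = c g3"
  shows False
proof -
  let ?D = "{g1, g2, g3}" and ?F = "{f1, f2, f3}"
  have "c ` ?F \<subseteq> c ` ?D" by (simp add: assms(15-17))
  then have img: "c ` (?F \<union> ?D) = c ` ?D" unfolding image_Un by (rule Un_absorb1)
  have "card (?F \<union> ?D) \<le> card (c ` (?F \<union> ?D)) + 2"
    using assms by (intro card_edges_le[of S]) auto
  then have "card (?F \<union> ?D) \<le> card (c ` ?D) + 2" unfolding img .
  moreover have "card (?F \<union> ?D) = card ?F + card ?D"
    using assms by (intro card_Un_disjoint) auto
  moreover have "card ?F = 3" using assms by simp
  moreover have "card (c ` ?D) \<le> card ?D" by (rule card_image_le) simp
  ultimately show False by linarith
qed

text \<open>An inequality, because in later applications some of the five vertices may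
  coincide.\<close>

lemma card_five_le: "card {p, q, r, s, t} \<le> 5"
  by (simp add: card_insert_if)

lemmas no_three = no_three_repetitions[OF _ card_five_le]

section \<open>Losses at a vertex and their base colours\<close>

text \<open>The loss \<open>(v, x)\<close> at \<open>v\<close> is compared with the smallest neighbour joined to \<open>v\<close> in
  the same colour; \<open>(v, x)\<close> is lossless if that neighbour is \<open>x\<close> itself.\<close>

definition first_nb :: "nat \<Rightarrow> nat \<Rightarrow> nat" where
  "first_nb v x = (LEAST y. y < n \<and> y \<noteq> v \<and> col v y = col v x)"

definition pairs :: "(nat \<times> nat) set" where
  "pairs = {(v, x). v < n \<and> x < n \<and> v \<noteq> x}"

definition redundant :: "(nat \<times> nat) set" where
  "redundant = {(v, x) \<in> pairs. first_nb v x \<noteq> x}"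

lemma first_nb:
  assumes "(v, x) \<in> pairs"
  shows "first_nb v x < n" "first_nb v x \<noteq> v" "col v (first_nb v x) = col v x"
    "first_nb v x \<le> x"
proof -
  let ?P = "\<lambda>y. y < n \<and> y \<noteq> v \<and> col v y = col v x"
  have *: "?P x" using assms by (auto simp: pairs_def)
  from LeastI[of ?P, OF *] show "first_nb v x < n" "first_nb v x \<noteq> v"
    "col v (first_nb v x) = col v x" by (auto simp: first_nb_def)
  from Least_le[of ?P, OF *] show "first_nb v x \<le> x" by (simp add: first_nb_def)
qed

lemma first_nb_cong: "col v x = col v x' \<Longrightarrow> first_nb v x = first_nb v x'"
  by (simp add: first_nb_def)

lemma redundantD:
  assumes "(v, x) \<in> redundant"
  shows "(v, x) \<in> pairs" "v < n" "x < n" "v \<noteq> x" "first_nb v x < n" "first_nb v x \<noteq> v"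
    "col v (first_nb v x) = col v x" "first_nb v x < x"
proof -
  show *: "(v, x) \<in> pairs" using assms by (auto simp: redundant_def)
  then show "v < n" "x < n" "v \<noteq> x" by (auto simp: pairs_def)
  show "first_nb v x < n" "first_nb v x \<noteq> v" "col v (first_nb v x) = col v x"
    using first_nb[OF *] by auto
  show "first_nb v x < x" using first_nb(4)[OF *] assms by (auto simp: redundant_def)
qed

definition base :: "nat \<Rightarrow> nat \<Rightarrow> nat" where
  "base v x = col x (first_nb v x)"

text \<open>Otherwise the two equal-coloured pairs at \<open>v\<close> and the two edges of the
  common base colour give three repetitions on \<open>v\<close>, \<open>x\<close>, \<open>x'\<close>
  and the two first neighbours.\<close>

lemma base_inj:
  assumes A: "(v, x) \<in> redundant" and B: "(v, x') \<in> redundant" and eq: "base v x = base v x'"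
  shows "x = x'"
proof (rule ccontr)
  assume ne: "x \<noteq> x'"
  let ?y = "first_nb v x" and ?y' = "first_nb v x'"
  note a = redundantD[OF A] and b = redundantD[OF B]
  \<comment> \<open>If \<open>?y = x'\<close>, both losses have the same colour at \<open>v\<close>,
    hence the same first neighbour, which would be smaller than itself.\<close>
  have 1: "?y \<noteq> x'"
    using first_nb_cong[of v x x'] a(7) b(8) by fastforce
  have 2: "?y' \<noteq> x"
    using first_nb_cong[of v x x'] b(7) a(8) by fastforce
  show False
    by (rule no_three[of v x ?y x' ?y' "{v, x}" "{v, x'}" "{x, ?y}" "{v, ?y}" "{v, ?y'}" "{x', ?y'}"])
      (use a b ne 1 2 eq in \<open>auto simp: doubleton_in_edges doubleton_eq_iff col_def base_def\<close>)
qed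

section \<open>Vertices seeing a colour, and monochromatic triangles\<close>

definition incident :: "nat \<Rightarrow> nat set" where
  "incident a = {v. v < n \<and> (\<exists>x<n. x \<noteq> v \<and> col v x = a)}"

definition mono_triangle :: "nat \<Rightarrow> nat \<Rightarrow> nat \<Rightarrow> nat \<Rightarrow> bool" where
  "mono_triangle a u v w \<longleftrightarrow> u < n \<and> v < n \<and> w < n \<and> u \<noteq> v \<and> u \<noteq> w \<and> v \<noteq> w \<and>
     col u v = a \<and> col u w = a \<and> col v w = a"

text \<open>The triangle alone has two repetitions, and with two more vertices there is room for any
  further edge of colour \<open>a\<close>, which would be a third.\<close>

lemma mono_triangle_edge:
  assumes T: "mono_triangle a u v w" and e: "p < n" "q < n" "p \<noteq> q" "col p q = a"
  shows "p \<in> {u, v, w}" "q \<in> {u, v, w}"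
proof -
  have "{p, q} \<in> {{u, v}, {u, w}, {v, w}}"
  proof (rule ccontr)
    assume ne: "\<not> ?thesis"
    show False
      by (rule no_three[of u v w p q "{u, v}" "{v, w}" "{p, q}" "{u, w}" "{u, w}" "{u, w}"])
        (use T e ne in \<open>auto simp: doubleton_in_edges doubleton_eq_iff col_def mono_triangle_def\<close>)
  qed
  then show "p \<in> {u, v, w}" "q \<in> {u, v, w}" by (auto simp: doubleton_eq_iff)
qed

lemma incident_mono_triangle:
  assumes "mono_triangle a u v w"
  shows "incident a = {u, v, w}"
proof
  show "incident a \<subseteq> {u, v, w}"
  proof
    fix p assume "p \<in> incident a"
    then obtain q where "p < n" "q < n" "p \<noteq> q" "col p q = a"
      by (auto simp: incident_def)
    then show "p \<in> {u, v, w}" by (rule mono_triangle_edge(1)[OF assms])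
  qed
  have "u \<in> incident a" "v \<in> incident a" "w \<in> incident a"
    using assms unfolding mono_triangle_def incident_def by (auto simp: col_commute)
  then show "{u, v, w} \<subseteq> incident a" by simp
qed

definition triangle_colors :: "nat set" where
  "triangle_colors = {a. \<exists>u v w. mono_triangle a u v w}"

lemma card_incident:
  "a \<in> triangle_colors \<Longrightarrow> card (incident a) = 3"
  by (auto simp: triangle_colors_def incident_mono_triangle)
    (auto simp: mono_triangle_def)

lemma redundant_triangle:
  assumes "(v, x) \<in> redundant" "base v x = col v x"
  shows "mono_triangle (col v x) v x (first_nb v x)"
  using redundantD[OF assms(1)] assms(2)
  by (auto simp: mono_triangle_def base_def)

text \<open>The colour has only two edges at \<open>v\<close>, and the smaller endpoint is the first
  neighbour, so just one loss remains.\<close>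

lemma redundant_triangle_inj:
  assumes A: "(v, x) \<in> redundant" "base v x = col v x"
    and B: "(v, x') \<in> redundant" "col v x' = col v x"
  shows "x' = x"
proof -
  have "x' \<in> {v, x, first_nb v x}"
    using redundantD[OF B(1)] B(2)
    by (intro mono_triangle_edge(2)[OF redundant_triangle[OF A]]) auto
  moreover have "first_nb v x' = first_nb v x" using B(2) by (rule first_nb_cong)
  ultimately show ?thesis using redundantD[OF B(1)] by auto
qed

text \<open>A missing base colour is never the colour of a monochromatic triangle, so the missing
  pairs that pay for triangles are not used elsewhere.\<close>

lemma base_not_triangle_color:
  assumes A: "(v, x) \<in> redundant" and miss: "v \<notin> incident (base v x)"
  shows "base v x \<notin> triangle_colors"
proof
  let ?y = "first_nb v x"
  note a = redundantD[OF A]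
  assume "base v x \<in> triangle_colors"
  then obtain p q r where T: "mono_triangle (base v x) p q r"
    by (auto simp: triangle_colors_def)
  have v: "v \<notin> {p, q, r}" using miss incident_mono_triangle[OF T] by simp
  have xy: "x \<in> {p, q, r}" "?y \<in> {p, q, r}"
    using mono_triangle_edge[OF T, of x ?y] a by (auto simp: base_def)
  \<comment> \<open>The triangle contributes two repetitions and the pair \<open>vx\<close>,
    \<open>v?y\<close> a third, all on the four vertices \<open>p\<close>, \<open>q\<close>,
    \<open>r\<close>, \<open>v\<close>.\<close>
  show False
    by (rule no_three[of p q r v v "{p, q}" "{q, r}" "{v, x}" "{p, r}" "{p, r}" "{v, ?y}"])
      (use T a v xy in \<open>auto simp: doubleton_in_edges doubleton_eq_iff col_def mono_triangle_def\<close>)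
qed

section \<open>Kites: four vertices with two repetitions\<close>

definition kite :: "nat \<Rightarrow> nat \<Rightarrow> nat \<Rightarrow> nat \<Rightarrow> bool" where
  "kite v x y z \<longleftrightarrow> {v, x, y, z} \<subseteq> {..<n} \<and> distinct [v, x, y, z] \<and>
     col v x = col v y \<and> col x y = col v z \<and> col v x \<noteq> col x y"

text \<open>The kite exhausts the two allowed repetitions, so an edge to a fifth vertex must have a
  colour of its own.\<close>

lemma kite_fresh_edge:
  assumes K: "kite v x y z" and w: "w < n" "w \<notin> {v, x, y, z}"
    and s: "s \<in> {v, x, y, z}" and e: "p \<in> {v, x, y, z, w}" "q \<in> {v, x, y, z, w}" "p \<noteq> q"
    and ne: "{p, q} \<noteq> {w, s}"
  shows "col w s \<noteq> col p q"
proof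
  assume eq: "col w s = col p q"
  \<comment> \<open>The edges \<open>vx\<close> and \<open>xy\<close> already serve as repeated
    edges, so if {p, q} is one of them, it is replaced by its partner of the same colour.\<close>
  define g where "g = (if {p, q} = {v, x} then {v, y} else if {p, q} = {x, y} then {v, z} else {p, q})"
  have "c g = c {p, q}" using K by (auto simp: g_def kite_def col_def)
  moreover have "g \<noteq> {v, x}" "g \<noteq> {x, y}" "g \<noteq> {w, s}" "g \<in> edges {v, x, y, z, w}"
    using K w e ne by (auto simp: g_def kite_def doubleton_eq_iff doubleton_in_edges)
  ultimately show False
    by (intro no_three[of v x y z w "{v, x}" "{x, y}" "{w, s}" "{v, y}" "{v, z}" g])
      (use K w s eq in \<open>auto simp: doubleton_in_edges doubleton_eq_iff col_def kite_def\<close>)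
qed

lemma kite_inner_edge:
  assumes K: "kite v x y z" and s: "s \<in> {x, y}"
    and e: "p \<in> {v, x, y, z}" "q \<in> {v, x, y, z}" "p \<noteq> q" and ne: "{p, q} \<noteq> {s, z}"
  shows "col s z \<noteq> col p q"
proof
  assume eq: "col s z = col p q"
  define g where "g = (if {p, q} = {v, x} then {v, y} else if {p, q} = {x, y} then {v, z} else {p, q})"
  have "c g = c {p, q}" using K by (auto simp: g_def kite_def col_def)
  moreover have "g \<noteq> {v, x}" "g \<noteq> {x, y}" "g \<noteq> {s, z}" "g \<in> edges {v, x, y, z, z}"
    using K s e ne by (auto simp: g_def kite_def doubleton_eq_iff doubleton_in_edges)
  ultimately show False
    by (intro no_three[of v x y z z "{v, x}" "{x, y}" "{s, z}" "{v, y}" "{v, z}" g])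
      (use K s eq in \<open>auto simp: doubleton_in_edges doubleton_eq_iff col_def kite_def\<close>)
qed

text \<open>By \<open>kite_inner_edge\<close>, \<open>xz\<close> and \<open>yz\<close> repeat no
  colour; \<open>xy\<close> and \<open>vz\<close> share one but do not meet. Only \<open>vx\<close>
  and \<open>vy\<close> remain.\<close>

lemma kite_cherry_unique:
  assumes K: "kite v x y z" and p: "p \<in> {v, x, y, z}" "q \<in> {v, x, y, z}" "r \<in> {v, x, y, z}"
    and d: "p \<noteq> q" "p \<noteq> r" "q \<noteq> r" and eq: "col p q = col p r"
  shows "p = v \<and> {q, r} = {x, y}"
proof -
  have k: "distinct [v, x, y, z]" "col v x = col v y" "col x y = col v z" "col v x \<noteq> col x y"
    using K by (auto simp: kite_def)
  have "col s z \<notin> {col v x, col x y}" if "s \<in> {x, y}" for s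
    using kite_inner_edge[OF K that, of v x] kite_inner_edge[OF K that, of x y] k(1) that
    by (auto simp: doubleton_eq_iff)
  then have i: "col x z \<noteq> col v x" "col x z \<noteq> col x y" "col y z \<noteq> col v x" "col y z \<noteq> col x y"
    by auto
  have "col x z \<noteq> col y z"
    using kite_inner_edge[OF K, of x y z] k(1) by (auto simp: doubleton_eq_iff)
  then show ?thesis
    using p d eq k i by (auto simp: col_commute)
qed

lemma kite_private:
  assumes K: "kite v x y z" and L: "kite v' x' y' z'"
    and two: "p \<in> {v, x, y}" "q \<in> {v, x, y}" "p \<noteq> q"
      "p \<in> {v', x', y', z'}" "q \<in> {v', x', y', z'}"
  shows "v = v' \<and> {x, y} = {x', y'}"
proof -
  let ?B = "{v', x', y', z'}"
  have k: "v < n" "x < n" "y < n" "z < n" "distinct [v, x, y, z]"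
    "col v x = col v y" "col x y = col v z"
    using K by (auto simp: kite_def)
  \<comment> \<open>If one of \<open>v\<close>, \<open>x\<close>, \<open>y\<close> were outside the
    second kite, its edge \<open>vx\<close> or \<open>vy\<close> leaving that kite would repeat a
    colour, against \<open>kite_fresh_edge\<close>.\<close>
  have three: "v \<in> ?B \<and> x \<in> ?B \<and> y \<in> ?B"
  proof (rule ccontr)
    assume "\<not> ?thesis"
    then consider "v \<notin> ?B" "x \<in> ?B" "y \<in> ?B" | "x \<notin> ?B" "v \<in> ?B" "y \<in> ?B"
      | "y \<notin> ?B" "v \<in> ?B" "x \<in> ?B"
      using two by blast
    then show False
    proof cases
      case 1
      then show False using kite_fresh_edge[OF L, of v x v y] k by (auto simp: doubleton_eq_iff)
    next
      case 2
      then show False using kite_fresh_edge[OF L, of x v v y] k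
        by (auto simp: doubleton_eq_iff col_commute)
    next
      case 3
      then show False using kite_fresh_edge[OF L, of y v v x] k
        by (auto simp: doubleton_eq_iff col_commute)
    qed
  qed
  then show ?thesis
    using kite_cherry_unique[OF L, of v x y] k by simp
qed

section \<open>Seven private ordered pairs for each kite loss\<close>

definition kite_losses :: "(nat \<times> nat) set" where
  "kite_losses = {(v, x) \<in> redundant. base v x \<noteq> col v x \<and> v \<in> incident (base v x)}"

definition fourth :: "nat \<Rightarrow> nat \<Rightarrow> nat" where
  "fourth v x = (SOME z. z < n \<and> z \<noteq> v \<and> col v z = base v x)"

lemma kite_lossesD:
  assumes "(v, x) \<in> kite_losses"
  shows "kite v x (first_nb v x) (fourth v x)" "col v (fourth v x) = base v x"
proof -
  have A: "(v, x) \<in> redundant" "base v x \<noteq> col v x" "v \<in> incident (base v x)"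
    using assms by (auto simp: kite_losses_def)
  then have "\<exists>z. z < n \<and> z \<noteq> v \<and> col v z = base v x"
    by (auto simp: incident_def)
  then have z: "fourth v x < n \<and> fourth v x \<noteq> v \<and> col v (fourth v x) = base v x"
    unfolding fourth_def by (rule someI_ex)
  then show "col v (fourth v x) = base v x" by simp
  show "kite v x (first_nb v x) (fourth v x)"
    using z redundantD[OF A(1)] A(2) unfolding kite_def base_def by auto
qed

text \<open>The fourth edge is taken only as seen from \<open>v\<close>: \<open>base_inj\<close>
  separates losses at one vertex, so the reverse pair is left to kites with apex
  \<open>fourth v x\<close>.\<close>

definition private_pairs :: "nat \<Rightarrow> nat \<Rightarrow> (nat \<times> nat) set" where
  "private_pairs v x = (let y = first_nb v x in
     {(v, x), (x, v), (v, y), (y, v), (x, y), (y, x), (v, fourth v x)})"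

lemma private_pairs:
  assumes "(v, x) \<in> kite_losses"
  shows "private_pairs v x \<subseteq> pairs" "card (private_pairs v x) = 7"
  using kite_lossesD(1)[OF assms]
  by (auto simp: private_pairs_def Let_def kite_def pairs_def)

lemma private_pairs_disjoint:
  assumes A: "(v, x) \<in> kite_losses" and B: "(v', x') \<in> kite_losses"
    and p: "(p, q) \<in> private_pairs v x" "(p, q) \<in> private_pairs v' x'"
  shows "v = v' \<and> x = x'"
proof -
  let ?y = "first_nb v x" and ?y' = "first_nb v' x'"
  let ?z = "fourth v x" and ?z' = "fourth v' x'"
  note K = kite_lossesD(1)[OF A] and L = kite_lossesD(1)[OF B]
  have R: "(v, x) \<in> redundant" "(v', x') \<in> redundant"
    using A B by (auto simp: kite_losses_def)
  have pq: "p \<noteq> q" using p(1) private_pairs(1)[OF A] by (auto simp: pairs_def)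
  have inA: "p \<in> {v, x, ?y, ?z}" "q \<in> {v, x, ?y, ?z}"
    and inB: "p \<in> {v', x', ?y', ?z'}" "q \<in> {v', x', ?y', ?z'}"
    using p by (auto simp: private_pairs_def Let_def)
  \<comment> \<open>The first neighbour is the smaller vertex of {x, ?y}, so the unordered pair
    determines \<open>x\<close>.\<close>
  have tri: "v = v' \<and> x = x'" if "v = v' \<and> {x, ?y} = {x', ?y'}"
    using that redundantD(8)[OF R(1)] redundantD(8)[OF R(2)]
    by (auto simp: doubleton_eq_iff)
  consider "p \<in> {v, x, ?y} \<and> q \<in> {v, x, ?y}" | "p \<in> {v', x', ?y'} \<and> q \<in> {v', x', ?y'}"
    | "(p, q) = (v, ?z)" "(p, q) = (v', ?z')"
    using p by (auto simp: private_pairs_def Let_def)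
  then show ?thesis
  proof cases
    case 1
    then show ?thesis using kite_private[OF K L _ _ pq inB] tri by blast
  next
    case 2
    then have "v' = v \<and> {x', ?y'} = {x, ?y}" using kite_private[OF L K _ _ pq inA] by blast
    then show ?thesis using tri by auto
  next
    case 3
    then have "v = v'" "base v x = base v' x'"
      using kite_lossesD(2)[OF A] kite_lossesD(2)[OF B] by auto
    then show ?thesis using base_inj R by blast
  qed
qed

lemma finite_pairs: "finite pairs"
  by (rule finite_subset[of _ "{..<n} \<times> {..<n}"]) (auto simp: pairs_def)

lemma card_pairs: "card pairs = n * (n - 1)"
proof -
  have "pairs = (SIGMA v:{..<n}. {..<n} - {v})" by (auto simp: pairs_def)
  then show ?thesis by simp
qed

lemma kite_losses_subset: "kite_losses \<subseteq> pairs"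
  by (auto simp: kite_losses_def redundant_def)

lemma card_kite_losses: "7 * card kite_losses \<le> n * (n - 1)"
proof -
  let ?F = "\<lambda>(v, x). private_pairs v x"
  have fin: "finite kite_losses" using finite_subset[OF kite_losses_subset finite_pairs] .
  have "card (\<Union>e\<in>kite_losses. ?F e) = (\<Sum>e\<in>kite_losses. card (?F e))"
  proof (rule card_UN_disjoint[OF fin])
    show "\<forall>e\<in>kite_losses. finite (?F e)"
      by (auto simp: private_pairs_def Let_def)
    show "\<forall>e\<in>kite_losses. \<forall>e'\<in>kite_losses. e \<noteq> e' \<longrightarrow> ?F e \<inter> ?F e' = {}"
      using private_pairs_disjoint by fastforce
  qed
  also have "\<dots> = 7 * card kite_losses"
    using private_pairs(2) by (simp add: case_prod_unfold)
  finally have "7 * card kite_losses = card (\<Union>e\<in>kite_losses. ?F e)" by simp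
  also have "\<dots> \<le> card pairs"
    using private_pairs(1) by (intro card_mono finite_pairs) fastforce
  finally show ?thesis by (simp add: card_pairs)
qed

section \<open>Counting pairs of a vertex and a colour\<close>

definition colors :: "nat set" where
  "colors = colors_used c {..<n}"

lemma finite_colors: "finite colors"
  by (simp add: colors_def colors_used_def finite_imp_finite_nsets)

lemma col_in_colors: "u < n \<Longrightarrow> v < n \<Longrightarrow> u \<noteq> v \<Longrightarrow> col u v \<in> colors"
  unfolding colors_def colors_used_def col_def
  by (rule imageI) (auto simp: nsets_def card_insert_if)

lemma triangle_colors_subset: "triangle_colors \<subseteq> colors"
  by (auto simp: triangle_colors_def mono_triangle_def intro: col_in_colors)

text \<open>Lossless pairs inject into the present pairs \<open>(v, a)\<close>, losses with a missing base
  colour into the missing pairs of non-triangle colours, and triangle losses into the missing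
  pairs of triangle colours.\<close>

lemma card_paid_pairs:
  assumes "6 \<le> n"
  shows "card (pairs - kite_losses) \<le> n * card colors"
proof -
  let ?N = "pairs - redundant"
  let ?M = "{(v, x) \<in> redundant. v \<notin> incident (base v x)}"
  let ?T = "{(v, x) \<in> redundant. base v x = col v x}"
  let ?present = "{(v, a). v < n \<and> a \<in> colors \<and> v \<in> incident a}"
  let ?missing = "{(v, a). v < n \<and> a \<in> colors - triangle_colors \<and> v \<notin> incident a}"
  let ?others = "{(v, a). v < n \<and> a \<in> triangle_colors \<and> v \<notin> incident a}"
  have finR: "finite redundant"
    by (rule finite_subset[OF _ finite_pairs]) (auto simp: redundant_def)
  have fin: "finite ?present" "finite ?missing" "finite ?others"
    using triangle_colors_subset
    by (auto intro: finite_subset[OF _ finite_cartesian_product[OF finite_lessThan[of n] finite_colors]])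
  have "card ?N \<le> card ?present"
  proof (rule card_inj_on_le[OF _ _ fin(1)])
    have "x = x'" if "(v, x) \<in> ?N" "(v, x') \<in> ?N" "col v x = col v x'" for v x x'
      using that first_nb_cong[OF that(3)] by (simp add: redundant_def)
    then show "inj_on (\<lambda>(v, x). (v, col v x)) ?N"
      by (auto simp: inj_on_def simp del: Diff_iff)
    show "(\<lambda>(v, x). (v, col v x)) ` ?N \<subseteq> ?present"
      by (auto simp: pairs_def incident_def intro!: col_in_colors)
  qed
  moreover have "card ?M \<le> card ?missing"
  proof (rule card_inj_on_le[OF _ _ fin(2)])
    show "inj_on (\<lambda>(v, x). (v, base v x)) ?M"
      using base_inj by (auto simp: inj_on_def)
    have "base v x \<in> colors" if "(v, x) \<in> redundant" for v x
      using redundantD[OF that] unfolding base_def by (intro col_in_colors) auto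
    then show "(\<lambda>(v, x). (v, base v x)) ` ?M \<subseteq> ?missing"
      using base_not_triangle_color by (auto dest: redundantD)
  qed
  moreover have "card ?T \<le> card ?others"
  proof -
    have finT: "finite triangle_colors"
      using finite_subset[OF triangle_colors_subset finite_colors] .
    have inc: "incident a \<subseteq> {..<n}" for a by (auto simp: incident_def)
    have "card ?T \<le> card (SIGMA a:triangle_colors. incident a)"
    proof (rule card_inj_on_le)
      show "inj_on (\<lambda>(v, x). (col v x, v)) ?T"
        using redundant_triangle_inj by (auto simp: inj_on_def)
      show "(\<lambda>(v, x). (col v x, v)) ` ?T \<subseteq> (SIGMA a:triangle_colors. incident a)"
        using redundant_triangle redundantD
        by (fastforce simp: triangle_colors_def incident_def)
      show "finite (SIGMA a:triangle_colors. incident a)"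
        using finT inc by (intro finite_SigmaI) (auto intro: finite_subset)
    qed
    also have "\<dots> = (\<Sum>a\<in>triangle_colors. card (incident a))"
      using finT inc by (intro card_SigmaI) (auto intro: finite_subset)
    \<comment> \<open>Here n \<ge> 6 enters: three vertices see \<open>a\<close>, and n - 3 \<ge> 3
      do not.\<close>
    also have "\<dots> \<le> (\<Sum>a\<in>triangle_colors. card ({..<n} - incident a))"
    proof (rule sum_mono)
      fix a assume "a \<in> triangle_colors"
      then show "card (incident a) \<le> card ({..<n} - incident a)"
        using card_incident[of a] inc[of a] assms
        by (simp add: card_Diff_subset finite_subset[OF inc])
    qed
    also have "\<dots> = card (SIGMA a:triangle_colors. {..<n} - incident a)"
      using finT by (intro card_SigmaI[symmetric]) auto
    also have "\<dots> = card ?others"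
      by (rule bij_betw_same_card[of "\<lambda>(a, v). (v, a)"])
        (auto simp: bij_betw_def inj_on_def image_iff)
    finally show ?thesis .
  qed
  \<comment> \<open>A loss that is not a kite loss has a missing base colour or lies in a
    monochromatic triangle.\<close>
  moreover have "card (pairs - kite_losses) \<le> card (?N \<union> ?M \<union> ?T)"
    using finite_pairs
    by (intro card_mono) (auto simp: kite_losses_def intro!: finite_subset[OF _ finR])
  moreover have "card (?N \<union> ?M \<union> ?T) \<le> card ?N + card ?M + card ?T"
    using card_Un_le[of "?N \<union> ?M" ?T] card_Un_le[of ?N ?M] by linarith
  moreover have "card ?present + card ?missing + card ?others = n * card colors"
  proof -
    have "{..<n} \<times> colors = ?present \<union> ?missing \<union> ?others"
      using triangle_colors_subset by auto
    moreover have "card (?present \<union> ?missing \<union> ?others)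
        = card (?present \<union> ?missing) + card ?others"
      using fin by (intro card_Un_disjoint) (auto simp: card_incident incident_def
          dest: subsetD[OF triangle_colors_subset])
    moreover have "card (?present \<union> ?missing) = card ?present + card ?missing"
      using fin by (intro card_Un_disjoint) auto
    ultimately show ?thesis
      by (metis card_cartesian_product card_lessThan)
  qed
  ultimately show ?thesis by linarith
qed

text \<open>For n \<ge> 6 the two counts give n(n - 1) \<le> nC + n(n - 1)/7, and n cancels. For n =
  5 the whole graph is one copy with at least 8 colours.\<close>

lemma colors_lower_bound: "6 * (n - 1) \<le> 7 * card colors"
proof (cases "n = 5")
  case True
  then have "{..<n} \<in> nsets {..<n} 5" by (simp add: nsets_def)
  then have "8 \<le> card colors"
    using coloring unfolding pq_coloring_def colors_def by (rule bspec[rotated])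
  then show ?thesis using True by simp
next
  case False
  have "n * (n - 1) = card (pairs - kite_losses) + card kite_losses"
    using kite_losses_subset finite_pairs
    by (metis card_pairs card_Diff_subset card_mono finite_subset le_add_diff_inverse2)
  then have "6 * (n * (n - 1)) \<le> 7 * (n * card colors)"
    using card_paid_pairs card_kite_losses False n5 by linarith
  then have "n * (6 * (n - 1)) \<le> n * (7 * card colors)" by (simp only: ac_simps)
  then show ?thesis using n5 by simp
qed

end

theorem theorem1p2:
  fixes n :: nat
  assumes "n \<ge> 1" and "n \<noteq> 3" and "n \<noteq> 4"
  shows "real (gen_ramsey n 5 8) \<ge> 6 / 7 * (real n - 1)"
proof -
  have "(8::nat) \<le> 5 choose 2" by (simp add: choose_two)
  from gen_ramsey_attained[OF this] obtain c where c: "pq_coloring n 5 8 c"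
    "card (colors_used c {..<n}) = gen_ramsey n 5 8" by blast
  consider "n = 1" | "n = 2" | "5 \<le> n" using assms by linarith
  then have "6 * (n - 1) \<le> 7 * gen_ramsey n 5 8"
  proof cases
    case 1
    then show ?thesis by simp
  next
    case 2
    then have "nsets {..<n} 2 \<noteq> {}" by (simp add: nsets_eq_empty_iff)
    moreover have "finite (nsets {..<n} 2)" by (simp add: finite_imp_finite_nsets)
    ultimately have "gen_ramsey n 5 8 > 0"
      unfolding c(2)[symmetric] colors_used_def by (simp add: card_gt_0_iff)
    then show ?thesis using 2 by simp
  next
    case 3
    then interpret coloring_5_8 n c using c by unfold_locales
    show ?thesis using colors_lower_bound c by (simp add: colors_def)
  qed
  then have "6 * real (n - 1) \<le> 7 * real (gen_ramsey n 5 8)"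
    by (metis (mono_tags) of_nat_le_iff of_nat_mult of_nat_numeral)
  then show ?thesis using assms(1) by (simp add: of_nat_diff)
qed

end
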